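(* $\mathsf{pdBW}=\mathsf{pdBW}_{-1}$, and $\mathsf{NORM}=\mathsf{NORM}_{-1}=\mathsf{NORM}_{0}=\mathsf{NORM}_{1}$.
   Context: A balancedly weighted vector space ($\mathsf{BW}$ space) $(X,\|\cdot\|)$ is a real topological vector space $X$ with a continuous map $\|\cdot\|:X\to[0,\infty)$ (the weight) such that $\|r\cdot\vec x\|=|r|\cdot\|\vec x\|$ for all $r\in\mathbb{R}$, $\vec x\in X$. The triangle inequality is not assumed. It is positive definite if $\|\vec x\|=0$ holds only for $\vec x=\vec 0$. Let $\mathsf{pdBW}$ be the class of all positive definite $\mathsf{BW}$ spaces and $\mathsf{NORM}$ the class of all real normed vector spaces. Let $(X,\|\cdot\|)\in\mathsf{pdBW}$ and $\varrho\in\mathbb{R}$. For $\vec x,\vec y\in X\setminus\{\vec 0\}$ put $\mathbf{s}=\left\|\frac{\vec x}{\|\vec x\|}+\frac{\vec y}{\|\vec y\|}\right\|$, $\mathbf{d}=\left\|\frac{\vec x}{\|\vec x\|}-\frac{\vec y}{\|\vec y\|}\right\|$, $\mathbf{\Sigma}=\mathbf{s}^2+\mathbf{d}^2$ (which is $>0$), $\mathbf{\Delta}=\mathbf{s}^2-\mathbf{d}^2$, and $\langle\vec x\,|\,\vec y\rangle_\varrho=\|\vec x\|\cdot\|\vec y\|\cdot\frac14\mathbf{\Delta}\cdot\left(\frac14\mathbf{\Sigma}\right)^{\varrho}$; put $\langle\vec x\,|\,\vec y\rangle_\varrho=0$ if $\vec x=\vec 0$ or $\vec y=\vec 0$. The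 space $(X,\|\cdot\|)$ "has the angle $\angle_\varrho$" if $|\langle\vec x\,|\,\vec y\rangle_\varrho|\le\|\vec x\|\cdot\|\vec y\|$ for all $\vec x,\vec y\in X$, i.e. if the angle $\angle_\varrho(\vec x,\vec y):=\arccos\frac{\langle\vec x|\vec y\rangle_\varrho}{\|\vec x\|\|\vec y\|}$ is defined for all $\vec x,\vec y\ne\vec 0$. $\mathsf{pdBW}_\varrho$ (resp. $\mathsf{NORM}_\varrho$) is the class of all members of $\mathsf{pdBW}$ (resp. $\mathsf{NORM}$) that have the angle $\angle_\varrho$. *)

theory Defs
  imports "HOL-Analysis.Analysis"
begin

(* A weighted space on a real vector space 'a is encoded as a pair (T, w) of a topology T
   on the whole type and a weight w.  The library has no topological vector spaces, and the
   topology cannot come from a type class here, since it is part of the structure.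
   No separation axiom is required. *)

definition topological_vector_space :: "'a::real_vector topology \<Rightarrow> bool" where
  "topological_vector_space T \<longleftrightarrow>
     topspace T = UNIV \<and>
     continuous_map (prod_topology T T) T (\<lambda>(x, y). x + y) \<and>
     continuous_map (prod_topology euclideanreal T) T (\<lambda>(r, x). r *\<^sub>R x)"

definition BW :: "('a::real_vector topology \<times> ('a \<Rightarrow> real)) set" where
  "BW = {(T, w). topological_vector_space T \<and>
                 continuous_map T euclideanreal w \<and>
                 (\<forall>x. 0 \<le> w x) \<and>
                 (\<forall>r x. w (r *\<^sub>R x) = \<bar>r\<bar> * w x)}"

definition pdBW :: "('a::real_vector topology \<times> ('a \<Rightarrow> real)) set" where
  "pdBW = {(T, w) \<in> BW. \<forall>x. w x = 0 \<longrightarrow> x = 0}"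

(* A normed space carries the topology induced by its norm. *)
definition NORM :: "('a::real_vector topology \<times> ('a \<Rightarrow> real)) set" where
  "NORM = {(T, w). (\<forall>x. 0 \<le> w x) \<and>
                   (\<forall>x. w x = 0 \<longleftrightarrow> x = 0) \<and>
                   (\<forall>r x. w (r *\<^sub>R x) = \<bar>r\<bar> * w x) \<and>
                   (\<forall>x y. w (x + y) \<le> w x + w y) \<and>
                   T = Metric_space.mtopology UNIV (\<lambda>x y. w (x - y))}"

definition bw_s :: "('a::real_vector \<Rightarrow> real) \<Rightarrow> 'a \<Rightarrow> 'a \<Rightarrow> real" where
  "bw_s w x y = w ((1 / w x) *\<^sub>R x + (1 / w y) *\<^sub>R y)"

definition bw_d :: "('a::real_vector \<Rightarrow> real) \<Rightarrow> 'a \<Rightarrow> 'a \<Rightarrow> real" where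
  "bw_d w x y = w ((1 / w x) *\<^sub>R x - (1 / w y) *\<^sub>R y)"

definition bw_Sigma :: "('a::real_vector \<Rightarrow> real) \<Rightarrow> 'a \<Rightarrow> 'a \<Rightarrow> real" where
  "bw_Sigma w x y = (bw_s w x y)\<^sup>2 + (bw_d w x y)\<^sup>2"

definition bw_Delta :: "('a::real_vector \<Rightarrow> real) \<Rightarrow> 'a \<Rightarrow> 'a \<Rightarrow> real" where
  "bw_Delta w x y = (bw_s w x y)\<^sup>2 - (bw_d w x y)\<^sup>2"

definition bw_product :: "real \<Rightarrow> ('a::real_vector \<Rightarrow> real) \<Rightarrow> 'a \<Rightarrow> 'a \<Rightarrow> real" where
  "bw_product \<rho> w x y =
     (if x = 0 \<or> y = 0 then 0
      else w x * w y * (1/4 * bw_Delta w x y) * (1/4 * bw_Sigma w x y) powr \<rho>)"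

definition has_angle :: "real \<Rightarrow> ('a::real_vector \<Rightarrow> real) \<Rightarrow> bool" where
  "has_angle \<rho> w \<longleftrightarrow> (\<forall>x y. \<bar>bw_product \<rho> w x y\<bar> \<le> w x * w y)"

definition pdBW_angle :: "real \<Rightarrow> ('a::real_vector topology \<times> ('a \<Rightarrow> real)) set" where
  "pdBW_angle \<rho> = {(T, w) \<in> pdBW. has_angle \<rho> w}"

definition NORM_angle :: "real \<Rightarrow> ('a::real_vector topology \<times> ('a \<Rightarrow> real)) set" where
  "NORM_angle \<rho> = {(T, w) \<in> NORM. has_angle \<rho> w}"

lemma real_normed_vector_in_NORM:
  "(euclidean, norm :: 'a::real_normed_vector \<Rightarrow> real) \<in> NORM"
proof -
  have "(\<lambda>x y::'a. norm (x - y)) = dist"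
    by (simp add: fun_eq_iff dist_norm)
  then show ?thesis
    by (auto simp: NORM_def norm_triangle_ineq)
qed

lemma NORM_subset_pdBW: "(NORM :: ('a::real_vector topology \<times> ('a \<Rightarrow> real)) set) \<subseteq> pdBW"
proof clarify
  fix T :: "'a topology" and w :: "'a \<Rightarrow> real"
  assume "(T, w) \<in> NORM"
  then have nn: "\<And>x. 0 \<le> w x" and pd: "\<And>x. w x = 0 \<longleftrightarrow> x = 0"
    and hom: "\<And>r x. w (r *\<^sub>R x) = \<bar>r\<bar> * w x" and tri: "\<And>x y. w (x + y) \<le> w x + w y"
    and T: "T = Metric_space.mtopology UNIV (\<lambda>x y. w (x - y))"
    by (auto simp: NORM_def)
  have [simp]: "w 0 = 0"
    by (simp add: pd)
  have neg: "w (- x) = w x" for x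
    using hom[of "-1" x] by simp
  interpret M: Metric_space UNIV "\<lambda>x y. w (x - y)"
  proof
    show "w (x - y) = w (y - x)" for x y
      using neg[of "x - y"] by simp
    show "w (x - z) \<le> w (x - y) + w (y - z)" for x y z
      using tri[of "x - y" "y - z"] by simp
  qed (auto simp: nn pd)
  have ball: "openin T (M.mball x e)" for x e
    by (simp add: T)
  have ts: "topspace T = UNIV"
    by (simp add: T)
  have add: "continuous_map (prod_topology T T) T (\<lambda>(x, y). x + y)"
  proof (subst (3) T, unfold M.continuous_map_to_metric, safe)
    fix x y :: 'a and e :: real
    assume e: "0 < e"
    let ?U = "M.mball x (e/2) \<times> M.mball y (e/2)"
    have "openin (prod_topology T T) ?U"
      by (simp add: openin_prod_Times_iff ball)
    moreover have "(x, y) \<in> ?U"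
      using e by simp
    moreover have "x' + y' \<in> M.mball (x + y) e" if "(x', y') \<in> ?U" for x' y'
    proof -
      have "w ((x + y) - (x' + y')) \<le> w (x - x') + w (y - y')"
        using tri[of "x - x'" "y - y'"] by (simp add: algebra_simps)
      with that show ?thesis by simp
    qed
    ultimately show "\<exists>U. openin (prod_topology T T) U \<and> (x, y) \<in> U \<and>
        (\<forall>z\<in>U. (case z of (x, y) \<Rightarrow> x + y) \<in> M.mball (x + y) e)"
      by (intro exI[of _ ?U]) auto
  qed
  have scale: "continuous_map (prod_topology euclideanreal T) T (\<lambda>(r, x). r *\<^sub>R x)"
  proof (subst (2) T, unfold M.continuous_map_to_metric, safe)
    fix r :: real and x :: 'a and e :: real
    assume e: "0 < e"
    define d where "d = min 1 (e / (2 * (w x + 1)))"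
    define c where "c = e / (2 * (\<bar>r\<bar> + 1))"
    have w1: "w x + 1 > 0" using nn[of x] by linarith
    have d: "d > 0" "d \<le> 1" "d * (w x + 1) \<le> e / 2"
    proof -
      show "d > 0" "d \<le> 1" using e w1 by (auto simp: d_def)
      have "d * (w x + 1) \<le> e / (2 * (w x + 1)) * (w x + 1)"
        using w1 by (intro mult_right_mono) (auto simp: d_def)
      also have "\<dots> = e / 2" using w1 by (simp add: field_simps)
      finally show "d * (w x + 1) \<le> e / 2" .
    qed
    have c: "c > 0" "c * (\<bar>r\<bar> + 1) = e / 2"
      using e by (auto simp: c_def field_simps add_nonneg_pos abs_add_one_gt_zero
          add_pos_nonneg)
    let ?U = "ball r d \<times> M.mball x c"
    have "openin (prod_topology euclideanreal T) ?U"
      by (simp add: openin_prod_Times_iff ball)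
    moreover have "(r, x) \<in> ?U"
      using c d by simp
    moreover have "r' *\<^sub>R x' \<in> M.mball (r *\<^sub>R x) e" if "(r', x') \<in> ?U" for r' x'
    proof -
      have r: "\<bar>r - r'\<bar> < d" and x: "w (x - x') < c"
        using that by (auto simp: dist_real_def)
      have "w (r *\<^sub>R x - r' *\<^sub>R x') \<le> w ((r - r') *\<^sub>R x) + w (r' *\<^sub>R (x - x'))"
        using tri[of "(r - r') *\<^sub>R x" "r' *\<^sub>R (x - x')"] by (simp add: algebra_simps)
      also have "\<dots> = \<bar>r - r'\<bar> * w x + \<bar>r'\<bar> * w (x - x')"
        by (simp only: hom)
      also have "\<bar>r'\<bar> * w (x - x') \<le> (\<bar>r\<bar> + 1) * c"
        using r d x nn[of "x - x'"] by (intro mult_mono) auto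
      also have "\<bar>r - r'\<bar> * w x \<le> d * w x"
        using r nn[of x] by (intro mult_right_mono) auto
      also have "d * w x + (\<bar>r\<bar> + 1) * c < e"
        using d c by (simp add: algebra_simps)
      finally show ?thesis by simp
    qed
    ultimately show "\<exists>U. openin (prod_topology euclideanreal T) U \<and> (r, x) \<in> U \<and>
        (\<forall>z\<in>U. (case z of (r, x) \<Rightarrow> r *\<^sub>R x) \<in> M.mball (r *\<^sub>R x) e)"
      by (intro exI[of _ ?U]) auto
  qed
  have cont: "continuous_map T euclideanreal w"
  proof (subst mtopology_is_euclidean[symmetric], unfold Met_TC.continuous_map_to_metric, safe)
    fix x :: 'a and e :: real
    assume e: "0 < e"
    have "w y \<in> Met_TC.mball (w x) e" if "y \<in> M.mball x e" for y
      using that tri[of "x - y" y] tri[of "y - x" x] neg[of "x - y"]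
      by (auto simp: dist_real_def)
    then show "\<exists>U. openin T U \<and> x \<in> U \<and> (\<forall>y\<in>U. w y \<in> Met_TC.mball (w x) e)"
      using e ball by (intro exI[of _ "M.mball x e"]) auto
  qed
  show "(T, w) \<in> pdBW"
    using ts add scale cont nn hom pd
    by (auto simp: pdBW_def BW_def topological_vector_space_def)
qed

end

theory Submission
  imports Defs
begin

text \<open>
  Put \<open>A = s\<^sup>2/4\<close> and \<open>B = d\<^sup>2/4\<close>, both nonnegative. Up to the factor \<open>w x * w y\<close>, the product
  of \<open>x\<close> and \<open>y\<close> is \<open>(A - B) * (A + B) powr \<rho>\<close>, so having the angle means that this quantity lies in
  \<open>[-1, 1]\<close> (\<open>has_angleI\<close>). For \<open>\<rho> = -1\<close> it is \<open>(A - B) / (A + B)\<close>, which is bounded by \<open>1\<close>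
  whatever the weight is.

  For a norm, the triangle inequality applied to the two unit vectors gives \<open>s, d \<le> 2\<close>, that is
  \<open>A, B \<le> 1\<close>. Then not only \<open>-1\<close>, \<open>0\<close> and \<open>1\<close> but every exponent in \<open>[-1, 1]\<close> satisfies the bound
  (\<open>abs_diff_mult_powr_le_1\<close>).
\<close>

lemma has_angleI:
  assumes nonneg: "\<And>x. 0 \<le> w x"
    and le: "\<And>x y. x \<noteq> 0 \<Longrightarrow> y \<noteq> 0 \<Longrightarrow>
      \<bar>(bw_s w x y)\<^sup>2 / 4 - (bw_d w x y)\<^sup>2 / 4\<bar> * ((bw_s w x y)\<^sup>2 / 4 + (bw_d w x y)\<^sup>2 / 4) powr \<rho> \<le> 1"
  shows "has_angle \<rho> w"
  unfolding has_angle_def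
proof (intro allI)
  fix x y
  show "\<bar>bw_product \<rho> w x y\<bar> \<le> w x * w y"
  proof (cases "x = 0 \<or> y = 0")
    case True
    then show ?thesis by (simp add: bw_product_def nonneg)
  next
    case False
    let ?A = "(bw_s w x y)\<^sup>2 / 4" and ?B = "(bw_d w x y)\<^sup>2 / 4"
    have "bw_product \<rho> w x y = (w x * w y) * ((?A - ?B) * (?A + ?B) powr \<rho>)"
      using False
      by (simp add: bw_product_def bw_Delta_def bw_Sigma_def add_divide_distrib diff_divide_distrib)
    then have "\<bar>bw_product \<rho> w x y\<bar> = (w x * w y) * (\<bar>?A - ?B\<bar> * (?A + ?B) powr \<rho>)"
      by (simp add: abs_mult nonneg)
    also have "\<dots> \<le> (w x * w y) * 1"
      using False by (intro mult_left_mono le) (auto simp: nonneg)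
    finally show ?thesis by simp
  qed
qed

lemma abs_diff_mult_powr_minus_one_le_1:
  fixes A B :: real
  assumes "0 \<le> A" "0 \<le> B"
  shows "\<bar>A - B\<bar> * (A + B) powr (-1) \<le> 1"
proof (cases "A + B = 0")
  case False
  then have "A + B > 0" using assms by linarith
  moreover have "\<bar>A - B\<bar> \<le> A + B" using assms by linarith
  ultimately show ?thesis by (simp add: powr_minus_divide)
next
  \<comment> \<open>The left-hand side is \<open>0\<close> here: \<open>A = B\<close>, and \<open>0\<close> to any real power is \<open>0\<close>.\<close>
  case True
  then show ?thesis by simp
qed

text \<open>
  As a function of \<open>\<rho>\<close>, \<open>(A + B) powr \<rho>\<close> is monotone, increasing or decreasing according to whether
  \<open>A + B\<close> is above or below \<open>1\<close>, so only an endpoint of \<open>[-1, 1]\<close> has to be examined. The exponent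
  \<open>1\<close> is where \<open>A, B \<le> 1\<close> enters, through \<open>\<bar>A\<^sup>2 - B\<^sup>2\<bar> \<le> 1\<close>.
\<close>

lemma abs_diff_mult_powr_le_1:
  fixes A B :: real
  assumes "0 \<le> A" "A \<le> 1" "0 \<le> B" "B \<le> 1" and \<rho>: "-1 \<le> \<rho>" "\<rho> \<le> 1"
  shows "\<bar>A - B\<bar> * (A + B) powr \<rho> \<le> 1"
proof (cases "A + B \<ge> 1")
  case True
  have "(A + B) powr \<rho> \<le> (A + B) powr 1"
    using \<rho> True by (intro powr_mono)
  then have "\<bar>A - B\<bar> * (A + B) powr \<rho> \<le> \<bar>A - B\<bar> * (A + B)"
    using True by (intro mult_left_mono) auto
  also have "\<dots> = \<bar>A\<^sup>2 - B\<^sup>2\<bar>"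
    using True by (simp add: abs_mult square_diff_square_factored power2_eq_square mult.commute)
  also have "\<dots> \<le> 1"
    using power_le_one[of A 2] power_le_one[of B 2] zero_le_power2[of A] zero_le_power2[of B] assms
    by linarith
  finally show ?thesis .
next
  case False
  have "(A + B) powr \<rho> \<le> (A + B) powr (-1)"
    using assms False by (intro powr_mono') auto
  then have "\<bar>A - B\<bar> * (A + B) powr \<rho> \<le> \<bar>A - B\<bar> * (A + B) powr (-1)"
    by (intro mult_left_mono) auto
  also have "\<dots> \<le> 1"
    using assms by (intro abs_diff_mult_powr_minus_one_le_1)
  finally show ?thesis .
qed

lemma pdBW_angle_minus_one: "pdBW_angle (-1) = pdBW"
  by (auto simp: pdBW_angle_def pdBW_def BW_def
      intro!: has_angleI abs_diff_mult_powr_minus_one_le_1)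

lemma NORM_angle_eq_NORM:
  assumes \<rho>: "-1 \<le> \<rho>" "\<rho> \<le> 1"
  shows "NORM_angle \<rho> = NORM"
proof -
  have "has_angle \<rho> w" if "(T, w) \<in> NORM" for T :: "'a topology" and w
  proof (rule has_angleI)
    have pos: "w x > 0" if "x \<noteq> 0" for x
      using \<open>(T, w) \<in> NORM\<close> that by (auto simp: NORM_def less_le)
    have hom: "w (r *\<^sub>R x) = \<bar>r\<bar> * w x" and tri: "w (x + y) \<le> w x + w y" for r x y
      using that by (auto simp: NORM_def)
    show nonneg: "0 \<le> w x" for x
      using that by (auto simp: NORM_def)
    fix x y :: 'a
    assume "x \<noteq> 0" "y \<noteq> 0"
    then have unit: "w ((1 / w x) *\<^sub>R x) = 1" "w ((1 / w y) *\<^sub>R y) = 1" "w (- ((1 / w y) *\<^sub>R y)) = 1"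
      using pos[of x] pos[of y] hom[of "-1" "(1 / w y) *\<^sub>R y"] by (simp_all add: hom)
    have "bw_s w x y \<le> 2" "bw_d w x y \<le> 2"
      using tri[of "(1 / w x) *\<^sub>R x" "(1 / w y) *\<^sub>R y"] tri[of "(1 / w x) *\<^sub>R x" "- ((1 / w y) *\<^sub>R y)"]
      by (simp_all add: bw_s_def bw_d_def unit)
    then have "(bw_s w x y)\<^sup>2 \<le> 2\<^sup>2" "(bw_d w x y)\<^sup>2 \<le> 2\<^sup>2"
      by (intro power_mono; simp add: bw_s_def bw_d_def nonneg)+
    then show "\<bar>(bw_s w x y)\<^sup>2 / 4 - (bw_d w x y)\<^sup>2 / 4\<bar>
        * ((bw_s w x y)\<^sup>2 / 4 + (bw_d w x y)\<^sup>2 / 4) powr \<rho> \<le> 1"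
      by (intro abs_diff_mult_powr_le_1 \<rho>) auto
  qed
  then show ?thesis
    by (auto simp: NORM_angle_def)
qed

theorem proposition5:
  shows "(pdBW :: ('a::real_vector topology \<times> ('a \<Rightarrow> real)) set) = pdBW_angle (-1) \<and>
         (NORM :: ('a topology \<times> ('a \<Rightarrow> real)) set) = NORM_angle (-1) \<and>
         (NORM_angle (-1) :: ('a topology \<times> ('a \<Rightarrow> real)) set) = NORM_angle 0 \<and>
         (NORM_angle 0 :: ('a topology \<times> ('a \<Rightarrow> real)) set) = NORM_angle 1"
  by (simp add: pdBW_angle_minus_one NORM_angle_eq_NORM)

end
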